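(* Let $n\ge 2$ and let $L\subseteq\mathbb{R}^n$ be a compact convex set. Then $L$ is $1$-reliable if and only if $L$ is a parallelotope.
   Context: All compact convex sets are nonempty. For a linear subspace $\xi$ of $\mathbb{R}^n$, $K_\xi$ denotes the orthogonal projection of $K$ onto $\xi$. A compact convex set $L\subseteq\mathbb{R}^n$ is $1$-reliable if, for every compact convex $K\subseteq\mathbb{R}^n$ such that $L_\xi$ contains a translate of $K_\xi$ for every $1$-dimensional linear subspace $\xi\subseteq\mathbb{R}^n$, the set $L$ contains a translate of $K$. A parallelotope is a $1$-decomposable set: there is a direct sum decomposition $\mathbb{R}^n=\xi_1\oplus\cdots\oplus\xi_m$ into linear subspaces of dimension at most $1$ and compact convex sets $L_i\subseteq\xi_i$ with $L=L_1+\cdots+L_m$ (Minkowski sum); equivalently, $L$ is the image under a nonsingular affine map of a box $\prod_{i=1}^n[a_i,b_i]$ with $a_i\le b_i$ (degenerate edges $a_i=b_i$ allowed). *)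

theory Defs
  imports "HOL-Analysis.Analysis"
begin

definition compact_convex_set :: "'a::euclidean_space set \<Rightarrow> bool" where
  "compact_convex_set K \<longleftrightarrow> compact K \<and> convex K \<and> K \<noteq> {}"

definition contains_translate :: "'a::euclidean_space set \<Rightarrow> 'a set \<Rightarrow> bool" where
  "contains_translate L K \<longleftrightarrow> (\<exists>v. (+) v ` K \<subseteq> L)"

(* For a subspace U, y is the orthogonal projection of x onto U iff y lies in U
   and x - y is orthogonal to U. *)
definition orth_proj_set :: "'a::euclidean_space set \<Rightarrow> 'a set \<Rightarrow> 'a set" where
  "orth_proj_set U K = {y \<in> U. \<exists>x\<in>K. \<forall>u\<in>U. orthogonal (x - y) u}"

definition reliable :: "nat \<Rightarrow> 'a::euclidean_space set \<Rightarrow> bool" where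
  "reliable d L \<longleftrightarrow> compact_convex_set L \<and>
     (\<forall>K. compact_convex_set K \<longrightarrow>
        (\<forall>U. subspace U \<and> dim U = d \<longrightarrow>
           contains_translate (orth_proj_set U L) (orth_proj_set U K)) \<longrightarrow>
        contains_translate L K)"

(* Using extensional functions makes the summands of x unique as a function of the index. *)
definition direct_sum_decomposition :: "nat \<Rightarrow> (nat \<Rightarrow> 'a::euclidean_space set) \<Rightarrow> bool" where
  "direct_sum_decomposition m U \<longleftrightarrow>
     (\<forall>i<m. subspace (U i)) \<and>
     (\<forall>x. \<exists>!v. v \<in> (\<Pi>\<^sub>E i\<in>{..<m}. U i) \<and> x = (\<Sum>i<m. v i))"

(* The sum of the sets M i is the Minkowski sum (HOL-Library.Set_Algebras). *)
definition decomposable :: "nat \<Rightarrow> 'a::euclidean_space set \<Rightarrow> bool" where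
  "decomposable d L \<longleftrightarrow>
     (\<exists>m U M. direct_sum_decomposition m U \<and>
        (\<forall>i<m. dim (U i) \<le> d \<and> compact_convex_set (M i) \<and> M i \<subseteq> U i) \<and>
        L = (\<Sum>i<m. M i))"

definition parallelotope :: "'a::euclidean_space set \<Rightarrow> bool" where
  "parallelotope L \<longleftrightarrow> decomposable 1 L"

end

theory Submission
  imports Defs
begin

text \<open>
  The shadow condition says that the width of \<open>K\<close> is at most that of \<open>L\<close> in every direction.
  For a parallelotope this suffices coordinate by coordinate. Conversely, a reliable \<open>L\<close> contains a
  translate of \<open>M = (L - L)/2\<close>, which has the same widths, so \<open>L\<close> is a translate of the symmetric
  body \<open>M\<close>, and every \<open>K\<close> with \<open>K - K \<subseteq> 2M\<close> fits into a translate of \<open>M\<close>. Such an \<open>M\<close> is the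
  intersection of the half-spaces \<open>u \<bullet> z \<le> 1\<close> at its smooth boundary points. If \<open>x\<close>, \<open>y\<close> are
  smooth with normals \<open>u \<noteq> -v\<close>, then \<open>(x - y)/2\<close> is a relative interior point of \<open>M\<close>, since a normal
  there would have to be both \<open>u\<close> and \<open>-v\<close>. Hence if smooth normals had a positive linear dependence
  without an opposite pair, a slight dilation of the hull of their contact points would still be
  coverable, which the dependence forbids. So the normals are, up to sign, linearly independent,
  and \<open>M\<close> is cut out by independent slabs.
\<close>

subsection \<open>Widths and the easy direction\<close>

lemma inner_attains_inf:
  fixes K :: "'a::euclidean_space set"
  assumes "compact_convex_set K"
  obtains q where "q \<in> K" "\<And>z. z \<in> K \<Longrightarrow> u \<bullet> q \<le> u \<bullet> z"
proof -
  have "continuous_on K ((\<bullet>) u)" by (intro continuous_intros)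
  then have "\<exists>q\<in>K. \<forall>z\<in>K. u \<bullet> q \<le> u \<bullet> z"
    using assms by (intro continuous_attains_inf) (auto simp: compact_convex_set_def)
  then show ?thesis using that by blast
qed

lemma inner_attains_sup:
  fixes K :: "'a::euclidean_space set"
  assumes "compact_convex_set K"
  obtains p where "p \<in> K" "\<And>z. z \<in> K \<Longrightarrow> u \<bullet> z \<le> u \<bullet> p"
  using inner_attains_inf[OF assms, of "- u"] by auto

lemma orth_proj_set_line:
  assumes "norm u = 1"
  shows "orth_proj_set (span {u}) K = (\<lambda>x. (u \<bullet> x) *\<^sub>R u) ` K"
proof -
  have u: "u \<bullet> u = 1" using assms by (simp add: dot_square_norm)
  have "(\<forall>v\<in>span {u}. orthogonal (x - c *\<^sub>R u) v) \<longleftrightarrow> c = u \<bullet> x" for c x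
    using assms by (auto simp: span_singleton orthogonal_def inner_diff_left u inner_commute[of x u])
  then show ?thesis
    unfolding orth_proj_set_def span_singleton by (auto simp: image_iff)
qed

text \<open>A shadow on a line is a segment as long as the width in that direction, and segments fit
  by length alone. Comparing single differences avoids suprema and lets \<open>u\<close> have any
  norm.\<close>

lemma translates_of_shadows_iff_widths_le:
  fixes K L :: "'a::euclidean_space set"
  assumes K: "compact_convex_set K" and L: "compact_convex_set L"
  shows "(\<forall>U. subspace U \<and> dim U = 1 \<longrightarrow>
            contains_translate (orth_proj_set U L) (orth_proj_set U K)) \<longleftrightarrow>
         (\<forall>u. \<forall>x\<in>K. \<forall>y\<in>K. \<exists>x'\<in>L. \<exists>y'\<in>L. u \<bullet> (x - y) \<le> u \<bullet> (x' - y'))"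
    (is "?shadows \<longleftrightarrow> ?widths")
proof
  assume sh: ?shadows
  show ?widths
  proof (intro allI ballI)
    fix u x y assume xy: "x \<in> K" "y \<in> K"
    show "\<exists>x'\<in>L. \<exists>y'\<in>L. u \<bullet> (x - y) \<le> u \<bullet> (x' - y')"
    proof (cases "u = 0")
      case True
      then show ?thesis using L by (auto simp: compact_convex_set_def)
    next
      case False
      define e where "e = u /\<^sub>R norm u"
      have e: "norm e = 1" "u = norm u *\<^sub>R e" using False by (auto simp: e_def)
      then have "dim (span {e}) = 1" by (auto simp: dim_span dim_singleton)
      then obtain v where v: "(+) v ` (\<lambda>x. (e \<bullet> x) *\<^sub>R e) ` K \<subseteq> (\<lambda>x. (e \<bullet> x) *\<^sub>R e) ` L"
        using sh e(1) unfolding contains_translate_def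
        by (metis orth_proj_set_line subspace_span)
      have "\<forall>z\<in>K. \<exists>z'\<in>L. v + (e \<bullet> z) *\<^sub>R e = (e \<bullet> z') *\<^sub>R e"
        using v unfolding image_image image_subset_iff image_iff .
      then obtain x' y' where xy': "x' \<in> L" "y' \<in> L"
        and eq: "v + (e \<bullet> x) *\<^sub>R e = (e \<bullet> x') *\<^sub>R e" "v + (e \<bullet> y) *\<^sub>R e = (e \<bullet> y') *\<^sub>R e"
        using xy by blast
      then have "(e \<bullet> (x - y)) *\<^sub>R e = (e \<bullet> (x' - y')) *\<^sub>R e"
        by (simp add: inner_diff_right scaleR_left_diff_distrib flip: eq)
      then have "e \<bullet> (x - y) = e \<bullet> (x' - y')" using e(1) by auto
      with xy' show ?thesis
        by (metis e(2) inner_scaleR_left order_refl)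
    qed
  qed
next
  assume wd: ?widths
  show ?shadows
  proof (intro allI impI)
    fix U :: "'a set" assume U: "subspace U \<and> dim U = 1"
    then obtain w where "w \<in> U" "w \<noteq> 0"
      by (metis dim_eq_0 subsetI singletonI zero_neq_one)
    define u where "u = w /\<^sub>R norm w"
    have u: "norm u = 1" "u \<in> U" using \<open>w \<noteq> 0\<close> \<open>w \<in> U\<close> U by (auto simp: u_def subspace_scale)
    have "span {u} = U"
      using u U by (intro subspace_dim_equal) (auto simp: span_minimal dim_singleton)
    obtain p q where p: "p \<in> K" "\<And>z. z \<in> K \<Longrightarrow> u \<bullet> z \<le> u \<bullet> p"
      and q: "q \<in> K" "\<And>z. z \<in> K \<Longrightarrow> u \<bullet> q \<le> u \<bullet> z"
      using inner_attains_sup[OF K] inner_attains_inf[OF K] by metis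
    obtain p' q' where p': "p' \<in> L" "\<And>z. z \<in> L \<Longrightarrow> u \<bullet> z \<le> u \<bullet> p'"
      and q': "q' \<in> L" "\<And>z. z \<in> L \<Longrightarrow> u \<bullet> q' \<le> u \<bullet> z"
      using inner_attains_sup[OF L] inner_attains_inf[OF L] by metis
    have w: "u \<bullet> p - u \<bullet> q \<le> u \<bullet> p' - u \<bullet> q'"
      using wd[rule_format, OF p(1) q(1), of u] p'(2) q'(2)
      by (fastforce simp: inner_diff_right)
    \<comment> \<open>The translation aligns the lower ends of the two shadows; connectedness of
      \<open>L\<close> supplies every value in between.\<close>
    have "((u \<bullet> q' - u \<bullet> q) *\<^sub>R u) + (u \<bullet> x) *\<^sub>R u \<in> (\<lambda>x. (u \<bullet> x) *\<^sub>R u) ` L"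
      if "x \<in> K" for x
    proof -
      have "u \<bullet> q' \<le> u \<bullet> q' - u \<bullet> q + u \<bullet> x" "u \<bullet> q' - u \<bullet> q + u \<bullet> x \<le> u \<bullet> p'"
        using p(2)[OF that] q(2)[OF that] w by linarith+
      moreover have "connected L" using L by (auto simp: compact_convex_set_def convex_connected)
      ultimately obtain z where "z \<in> L" "u \<bullet> z = u \<bullet> q' - u \<bullet> q + u \<bullet> x"
        using connected_ivt_hyperplane[of L q' p' u] p'(1) q'(1) by blast
      then show ?thesis by (metis image_eqI scaleR_left_distrib)
    qed
    then show "contains_translate (orth_proj_set U L) (orth_proj_set U K)"
      unfolding contains_translate_def \<open>span {u} = U\<close>[symmetric] orth_proj_set_line[OF u(1)]
      by blast
  qed
qed

section \<open>Parallelotopes are reliable\<close>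

lemma subspace_dim_le_1_obtain:
  fixes U :: "'a::euclidean_space set"
  assumes "subspace U" "dim U \<le> 1"
  obtains e where "e \<in> U" "\<And>x. x \<in> U \<Longrightarrow> x = (e \<bullet> x) *\<^sub>R e"
proof (cases "dim U = 0")
  case True
  \<comment> \<open>The zero vector serves in dimension 0, so degenerate summands need no separate
    treatment.\<close>
  then show ?thesis using that[of 0] assms(1) by (auto simp: dim_eq_0 subspace_0)
next
  case False
  then obtain w where "w \<in> U" "w \<noteq> 0" by (metis dim_eq_0 subsetI singletonI)
  define e where "e = w /\<^sub>R norm w"
  have e: "e \<bullet> e = 1" "e \<in> U" using \<open>w \<noteq> 0\<close> \<open>w \<in> U\<close> assms
    by (auto simp: e_def subspace_scale dot_square_norm power2_eq_square)
  have "span {e} = U"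
    using e assms False by (intro subspace_dim_equal) (auto simp: span_minimal dim_singleton)
  with e show ?thesis by (intro that[of e]) (auto simp: span_singleton)
qed

text \<open>In a summand of dimension at most 1 the component of a point is governed by one linear
  functional. The width bound for it lets that component be shifted into place, and directness of
  the sum allows all shifts at once.\<close>

lemma parallelotope_imp_reliable:
  fixes L :: "'a::euclidean_space set"
  assumes L: "compact_convex_set L" and "parallelotope L"
  shows "reliable 1 L"
proof -
  obtain m U M where dec: "direct_sum_decomposition m U"
    and M: "\<forall>i<m. dim (U i) \<le> 1 \<and> compact_convex_set (M i) \<and> M i \<subseteq> U i"
    and LM: "L = (\<Sum>i<m. M i)"
    using assms(2) unfolding parallelotope_def decomposable_def by blast
  have U: "subspace (U i)" if "i < m" for i
    using dec that unfolding direct_sum_decomposition_def by auto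
  have uniq: "\<exists>!v. v \<in> (\<Pi>\<^sub>E i\<in>{..<m}. U i) \<and> x = (\<Sum>i<m. v i)" for x
    using dec unfolding direct_sum_decomposition_def by auto
  define comp where "comp x = (THE v. v \<in> (\<Pi>\<^sub>E i\<in>{..<m}. U i) \<and> x = (\<Sum>i<m. v i))" for x
  have comp_sum: "x = (\<Sum>i<m. comp x i)" and comp_mem: "i < m \<Longrightarrow> comp x i \<in> U i" for x i
    using theI'[OF uniq[of x]] unfolding comp_def by auto
  have comp_eq: "comp x i = v i" if "\<And>i. i < m \<Longrightarrow> v i \<in> U i" "x = (\<Sum>i<m. v i)" "i < m" for x v i
  proof -
    have "comp x = restrict v {..<m}"
      unfolding comp_def using that by (intro the1_equality[OF uniq]) auto
    with that show ?thesis by auto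
  qed
  have comp_add: "comp (x + y) i = comp x i + comp y i" if "i < m" for x y i
    using that
    by (intro comp_eq) (auto simp: comp_mem U subspace_add sum.distrib comp_sum[symmetric])
  have comp_scale: "comp (c *\<^sub>R x) i = c *\<^sub>R comp x i" if "i < m" for c x i
    using that
    by (intro comp_eq)
      (auto simp: comp_mem U subspace_scale scaleR_sum_right[symmetric] comp_sum[symmetric])
  have L_comp: "x \<in> L \<longleftrightarrow> (\<forall>i<m. comp x i \<in> M i)" for x
  proof
    assume "x \<in> L"
    then obtain s where s: "x = sum s {..<m}" "\<forall>i\<in>{..<m}. s i \<in> M i"
      unfolding LM set_sum_alt[OF finite_lessThan] by auto
    then have "comp x i = s i" if "i < m" for i using that M by (intro comp_eq) auto
    with s show "\<forall>i<m. comp x i \<in> M i" by auto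
  next
    assume "\<forall>i<m. comp x i \<in> M i"
    then show "x \<in> L" unfolding LM set_sum_alt[OF finite_lessThan] using comp_sum[of x] by auto
  qed
  have "contains_translate L K" if K: "compact_convex_set K"
    and wd: "\<forall>u. \<forall>x\<in>K. \<forall>y\<in>K. \<exists>x'\<in>L. \<exists>y'\<in>L. u \<bullet> (x - y) \<le> u \<bullet> (x' - y')" for K
  proof -
    have "\<exists>w\<in>U i. \<forall>x\<in>K. w + comp x i \<in> M i" if i: "i < m" for i
    proof -
      obtain e where e: "e \<in> U i" "\<And>x. x \<in> U i \<Longrightarrow> x = (e \<bullet> x) *\<^sub>R e"
        using subspace_dim_le_1_obtain[OF U[OF i]] M i by metis
      define \<phi> where "\<phi> x = e \<bullet> comp x i" for x
      have "linear \<phi>"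
        by (intro linearI) (auto simp: \<phi>_def comp_add[OF i] comp_scale[OF i] inner_add_right)
      \<comment> \<open>\<open>b\<close> represents \<open>\<phi>\<close> as an inner product, so
        the width hypothesis applies in direction \<open>b\<close>.\<close>
      define b where "b = adjoint \<phi> 1"
      have b: "\<phi> x = b \<bullet> x" for x
        using adjoint_works[OF \<open>linear \<phi>\<close>, of x 1] by (simp add: b_def inner_commute)
      have Mi: "compact (M i)" "convex (M i)" "M i \<noteq> {}" "M i \<subseteq> U i"
        using M i by (auto simp: compact_convex_set_def)
      have "connected ((\<bullet>) e ` M i)" "compact ((\<bullet>) e ` M i)"
        using Mi(1) convex_connected[OF Mi(2)]
        by (auto intro!: connected_continuous_image compact_continuous_image continuous_on_inner
            continuous_on_const continuous_on_id)
      then obtain lo hi where lohi: "(\<bullet>) e ` M i = {lo..hi}"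
        by (metis connected_compact_interval_1)
      obtain q where q: "q \<in> K" "\<And>z. z \<in> K \<Longrightarrow> b \<bullet> q \<le> b \<bullet> z"
        using inner_attains_inf[OF K] by metis
      \<comment> \<open>The shift takes the minimum of \<open>\<phi>\<close> on \<open>K\<close> to
        \<open>lo\<close>; the width bound keeps all other values at most \<open>hi\<close>.\<close>
      have "(lo - \<phi> q) *\<^sub>R e + comp x i \<in> M i" if x: "x \<in> K" for x
      proof -
        obtain x' y' where xy': "x' \<in> L" "y' \<in> L" "b \<bullet> (x - q) \<le> b \<bullet> (x' - y')"
          using wd x q(1) by blast
        then have "\<phi> x' \<in> {lo..hi}" "\<phi> y' \<in> {lo..hi}"
          using L_comp i by (auto simp: \<phi>_def lohi[symmetric])
        then have "lo - \<phi> q + \<phi> x \<in> {lo..hi}"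
          using xy'(3) q(2)[OF x] by (auto simp: b inner_diff_right)
        then obtain z where z: "z \<in> M i" "lo - \<phi> q + \<phi> x = e \<bullet> z"
          unfolding lohi[symmetric] by auto
        have "(lo - \<phi> q) *\<^sub>R e + comp x i = (lo - \<phi> q) *\<^sub>R e + \<phi> x *\<^sub>R e"
          using e(2)[OF comp_mem[OF i, of x]] by (simp add: \<phi>_def)
        also have "\<dots> = (e \<bullet> z) *\<^sub>R e" by (simp add: z(2)[symmetric] scaleR_left_distrib)
        also have "\<dots> = z" using e(2)[of z] z(1) Mi(4) by auto
        finally show ?thesis using z(1) by simp
      qed
      then show ?thesis using e(1) U[OF i] by (meson subspace_scale)
    qed
    then obtain w where w: "\<And>i. i < m \<Longrightarrow> w i \<in> U i"
      "\<And>i x. i < m \<Longrightarrow> x \<in> K \<Longrightarrow> w i + comp x i \<in> M i" by metis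
    have "(\<Sum>i<m. w i) + x \<in> L" if "x \<in> K" for x
    proof -
      have "comp ((\<Sum>i<m. w i) + x) i = w i + comp x i" if "i < m" for i
        using that w(1)
        by (intro comp_eq) (auto simp: U subspace_add comp_mem sum.distrib comp_sum[symmetric])
      then show ?thesis using w(2) that by (simp add: L_comp)
    qed
    then show ?thesis unfolding contains_translate_def by auto
  qed
  then show ?thesis
    using L translates_of_shadows_iff_widths_le unfolding reliable_def by blast
qed

subsection \<open>Intersections of independent slabs\<close>

text \<open>The coordinate functional of \<open>c\<close> extends linearly to the whole space, and
  its adjoint at 1 represents it.\<close>

lemma dual_basis:
  fixes B :: "'a::euclidean_space set"
  assumes "independent B"
  obtains e where "\<And>b c. b \<in> B \<Longrightarrow> c \<in> B \<Longrightarrow> b \<bullet> e c = (if b = c then 1 else 0)"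
proof -
  have "\<exists>e. \<forall>b\<in>B. b \<bullet> e = (if b = c then 1 else 0)" for c
  proof -
    obtain g :: "'a \<Rightarrow> real" where g: "linear g" "\<forall>b\<in>B. g b = (if b = c then 1 else 0)"
      using linear_independent_extend[OF assms, of "\<lambda>b. if b = c then 1 else 0"] by blast
    then show ?thesis using adjoint_works[OF g(1), of _ 1] by (intro exI[of _ "adjoint g 1"]) auto
  qed
  then show ?thesis using that by metis
qed

text \<open>The numbers \<open>b \<bullet> x\<close> are the coordinates of \<open>x\<close> in the
  basis dual to \<open>B\<close>, where the slabs cut out a box. Slabs of zero thickness serve
  bodies with empty interior.\<close>

lemma parallelotope_if_slabs:
  fixes B :: "'a::euclidean_space set"
  assumes "independent B"
    and complete: "\<And>x. (\<And>b. b \<in> B \<Longrightarrow> b \<bullet> x = 0) \<Longrightarrow> x = 0"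
    and le: "\<And>b. b \<in> B \<Longrightarrow> lo b \<le> hi b"
  shows "parallelotope {x. \<forall>b\<in>B. lo b \<le> b \<bullet> x \<and> b \<bullet> x \<le> hi b}" (is "parallelotope ?L")
proof -
  obtain e where e: "\<And>b c. b \<in> B \<Longrightarrow> c \<in> B \<Longrightarrow> b \<bullet> e c = (if b = c then 1 else 0)"
    using dual_basis[OF assms(1)] by blast
  have "finite B" using assms(1) by (rule independent_imp_finite)
  define m where "m = card B"
  obtain h where h: "bij_betw h {..<m} B"
    using ex_bij_betw_nat_finite[OF \<open>finite B\<close>] by (auto simp: m_def atLeast0LessThan)
  have hB: "h i \<in> B" if "i < m" for i using h that by (auto simp: bij_betw_def)
  have Bh: "\<exists>i<m. b = h i" if "b \<in> B" for b using h that by (auto simp: bij_betw_def image_iff)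
  have he: "h j \<bullet> e (h i) = (if j = i then 1 else 0)" if "i < m" "j < m" for i j
    using e[OF hB hB] that h by (auto simp: bij_betw_def inj_on_def)
  have coord: "h j \<bullet> (\<Sum>i<m. t i *\<^sub>R e (h i)) = t j" if "j < m" for t j
    using that by (simp add: inner_sum_right he if_distrib cong: if_cong)
  have expand: "x = (\<Sum>i<m. (h i \<bullet> x) *\<^sub>R e (h i))" for x
  proof -
    have "x - (\<Sum>i<m. (h i \<bullet> x) *\<^sub>R e (h i)) = 0"
    proof (rule complete)
      fix b assume "b \<in> B"
      then obtain j where "j < m" "b = h j" using Bh by blast
      then show "b \<bullet> (x - (\<Sum>i<m. (h i \<bullet> x) *\<^sub>R e (h i))) = 0" by (simp add: inner_diff_right coord)
    qed
    then show ?thesis by simp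
  qed
  define U where "U i = span {e (h i)}" for i
  define M where "M i = (\<lambda>t. t *\<^sub>R e (h i)) ` {lo (h i)..hi (h i)}" for i
  have "direct_sum_decomposition m U"
    unfolding direct_sum_decomposition_def
  proof (intro conjI allI impI)
    show "subspace (U i)" for i by (simp add: U_def)
    fix x
    show "\<exists>!v. v \<in> (\<Pi>\<^sub>E i\<in>{..<m}. U i) \<and> x = (\<Sum>i<m. v i)"
    proof (rule ex1I[of _ "\<lambda>i\<in>{..<m}. (h i \<bullet> x) *\<^sub>R e (h i)"])
      show "(\<lambda>i\<in>{..<m}. (h i \<bullet> x) *\<^sub>R e (h i)) \<in> (\<Pi>\<^sub>E i\<in>{..<m}. U i) \<and>
          x = (\<Sum>i<m. (\<lambda>i\<in>{..<m}. (h i \<bullet> x) *\<^sub>R e (h i)) i)"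
        using expand[of x] by (auto simp: U_def span_singleton)
    next
      fix v assume v: "v \<in> (\<Pi>\<^sub>E i\<in>{..<m}. U i) \<and> x = (\<Sum>i<m. v i)"
      then have "\<forall>i<m. \<exists>t. v i = t *\<^sub>R e (h i)" by (auto simp: U_def span_singleton PiE_iff)
      then obtain t where t: "\<And>i. i < m \<Longrightarrow> v i = t i *\<^sub>R e (h i)" by metis
      then have "x = (\<Sum>i<m. t i *\<^sub>R e (h i))" using v by simp
      then have "h i \<bullet> x = t i" if "i < m" for i using that coord by simp
      then show "v = (\<lambda>i\<in>{..<m}. (h i \<bullet> x) *\<^sub>R e (h i))"
        using v t by (auto simp: PiE_iff extensional_def)
    qed
  qed
  moreover have "dim (U i) \<le> 1 \<and> compact_convex_set (M i) \<and> M i \<subseteq> U i" if "i < m" for i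
  proof (intro conjI)
    show "dim (U i) \<le> 1" by (simp add: U_def dim_singleton)
    have "linear (\<lambda>t. t *\<^sub>R e (h i))" by (intro linearI) (auto simp: algebra_simps)
    then show "compact_convex_set (M i)"
      unfolding compact_convex_set_def M_def using le[OF hB[OF that]]
      by (auto intro!: compact_continuous_image continuous_intros convex_linear_image)
    show "M i \<subseteq> U i" by (auto simp: M_def U_def span_singleton)
  qed
  moreover have "?L = (\<Sum>i<m. M i)"
  proof (intro set_eqI iffI)
    fix x assume "x \<in> ?L"
    then have "\<forall>i\<in>{..<m}. (h i \<bullet> x) *\<^sub>R e (h i) \<in> M i" using hB by (auto simp: M_def)
    then show "x \<in> (\<Sum>i<m. M i)"
      unfolding set_sum_alt[OF finite_lessThan] using expand[of x] by blast
  next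
    fix x assume "x \<in> (\<Sum>i<m. M i)"
    then obtain s where s: "x = sum s {..<m}" "\<forall>i\<in>{..<m}. s i \<in> M i"
      unfolding set_sum_alt[OF finite_lessThan] by auto
    have "\<forall>i<m. \<exists>t\<in>{lo (h i)..hi (h i)}. s i = t *\<^sub>R e (h i)" using s(2) by (auto simp: M_def)
    then obtain t where t: "\<And>i. i < m \<Longrightarrow> t i \<in> {lo (h i)..hi (h i)} \<and> s i = t i *\<^sub>R e (h i)"
      by metis
    then have "x = (\<Sum>i<m. t i *\<^sub>R e (h i))" using s(1) by simp
    then have "h i \<bullet> x = t i" if "i < m" for i using that coord by simp
    then show "x \<in> ?L" using t Bh by fastforce
  qed
  ultimately show ?thesis unfolding parallelotope_def decomposable_def by blast
qed

subsection \<open>Smooth normals of a symmetric body\<close>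

text \<open>\<open>M\<close> may have empty interior, so interiors and normals are taken relative to
  \<open>span M\<close>.\<close>

locale symmetric_convex =
  fixes M :: "'a::euclidean_space set"
  assumes compact_M: "compact M" and convex_M: "convex M" and M_nonempty: "M \<noteq> {}"
    and uminus_mem: "x \<in> M \<Longrightarrow> - x \<in> M"
begin

lemma zero_mem: "0 \<in> M"
proof -
  obtain x where "x \<in> M" using M_nonempty by blast
  then have "(1/2) *\<^sub>R x + (1/2) *\<^sub>R (- x) \<in> M"
    using convex_M uminus_mem by (intro convexD) auto
  then show ?thesis by simp
qed

lemma scale_mem: "c *\<^sub>R x \<in> M" if "x \<in> M" "0 \<le> c" "c \<le> 1"
  using convexD[OF convex_M that(1) zero_mem, of c "1 - c"] that by simp

lemma zero_rel_interior: "0 \<in> rel_interior M"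
  unfolding convex_rel_interior_iff[OF convex_M M_nonempty]
  \<comment> \<open>Prolonging the segment from \<open>x\<close> to 0 by the factor 2 ends at
    \<open>- x\<close>.\<close>
  using uminus_mem by (auto intro!: exI[of _ 2])

lemma cball_Int_span_subset: obtains r where "0 < r" "cball 0 r \<inter> span M \<subseteq> M"
  using zero_rel_interior
  unfolding mem_rel_interior_cball affine_hull_span_0[OF hull_inc[OF zero_mem]] by blast

text \<open>Orthogonal projection of a normal onto the span changes no value on \<open>M\<close>;
  this brings separating and supporting normals into \<open>polar\<close>.\<close>

lemma inner_eq_on_span: obtains a' where "a' \<in> span M" "\<And>x. x \<in> span M \<Longrightarrow> a' \<bullet> x = a \<bullet> x"
proof -
  obtain y z where "y \<in> span M" "\<And>w. w \<in> span M \<Longrightarrow> orthogonal z w" "a = y + z"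
    using orthogonal_subspace_decomp_exists by blast
  then show ?thesis by (intro that[of y]) (auto simp: inner_add_left orthogonal_def)
qed

definition polar :: "'a set" where
  "polar = {a \<in> span M. \<forall>z\<in>M. a \<bullet> z \<le> 1}"

text \<open>A relative boundary point with a single supporting normal, scaled to take the value 1
  there.\<close>

definition smooth_at :: "'a \<Rightarrow> 'a \<Rightarrow> bool" where
  "smooth_at x u \<longleftrightarrow> x \<in> M \<and> u \<in> polar \<and> u \<bullet> x = 1 \<and> (\<forall>b\<in>polar. b \<bullet> x = 1 \<longrightarrow> b = u)"

lemma uminus_polar: "- u \<in> polar" if "u \<in> polar"
  using that uminus_mem by (fastforce simp: polar_def span_neg)

lemma smooth_at_uminus: "smooth_at (- x) (- u)" if "smooth_at x u"
proof -
  have "b = - u" if "b \<in> polar" "b \<bullet> (- x) = 1" for b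
    using \<open>smooth_at x u\<close> uminus_polar[OF that(1)] that(2)
    unfolding smooth_at_def by (metis inner_minus_left inner_minus_right minus_minus)
  with that show ?thesis by (auto simp: smooth_at_def uminus_mem uminus_polar)
qed

lemma polar_separation:
  assumes "x \<in> span M" "x \<notin> M"
  obtains a where "a \<in> polar" "1 < a \<bullet> x"
proof -
  obtain c d where "c \<bullet> x < d" and cd: "\<And>z. z \<in> M \<Longrightarrow> d < c \<bullet> z"
    using separating_hyperplane_closed_point[OF convex_M compact_imp_closed[OF compact_M] assms(2)]
    by blast
  \<comment> \<open>Since 0 lies in \<open>M\<close>, \<open>d\<close> is negative, and division by
    it turns \<open>d < c \<bullet> z\<close> into an upper bound 1.\<close>
  have "d < 0" using cd[OF zero_mem] by simp
  obtain a where a: "a \<in> span M" "\<And>x. x \<in> span M \<Longrightarrow> a \<bullet> x = (c /\<^sub>R d) \<bullet> x"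
    using inner_eq_on_span by blast
  have "a \<bullet> z \<le> 1" if "z \<in> M" for z
    using cd[OF that] \<open>d < 0\<close> that by (simp add: a(2) span_base divide_simps inverse_eq_divide)
  moreover have "1 < a \<bullet> x"
    using \<open>c \<bullet> x < d\<close> \<open>d < 0\<close> assms by (simp add: a(2) divide_simps inverse_eq_divide)
  ultimately show ?thesis using that a(1) by (auto simp: polar_def)
qed

lemma norm_polar_bounded:
  obtains R where "0 < R" "\<forall>a\<in>polar. norm a \<le> R"
proof -
  obtain r where r: "0 < r" "cball 0 r \<inter> span M \<subseteq> M" by (rule cball_Int_span_subset)
  have "norm a \<le> 1 / r" if "a \<in> polar" for a
  proof (cases "a = 0")
    case False
    \<comment> \<open>The point at distance \<open>r\<close> in direction \<open>a\<close> lies in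
      \<open>M\<close>, which bounds \<open>r * norm a\<close> by 1.\<close>
    have "(r / norm a) *\<^sub>R a \<in> M"
      using r False that by (auto simp: polar_def span_scale intro!: subsetD[OF r(2)])
    then have "a \<bullet> ((r / norm a) *\<^sub>R a) \<le> 1" using that unfolding polar_def by blast
    then have "r / norm a * (a \<bullet> a) \<le> 1" by simp
    then have "r * norm a \<le> 1" using False by (simp add: dot_square_norm power2_eq_square)
    then show ?thesis using r(1) by (simp add: field_simps)
  qed (use r in auto)
  then show ?thesis using that[of "1 / r"] r(1) by simp
qed

lemma compact_polar: "compact polar"
proof -
  have "polar = span M \<inter> (\<Inter>z\<in>M. {a. z \<bullet> a \<le> 1})" by (auto simp: polar_def inner_commute)
  then have "closed polar" by (auto intro!: closed_Int closed_INT closed_halfspace_le closed_span)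
  moreover have "bounded polar" using norm_polar_bounded by (metis bounded_iff)
  ultimately show ?thesis by (simp add: compact_eq_bounded_closed)
qed

text \<open>A relatively interior point can be pushed away from 0. At any other point a supporting
  hyperplane misses 0, which is relatively interior, so its normal can be scaled to the value
  1.\<close>

lemma stretch_or_supported:
  assumes "m \<in> M"
  obtains e where "1 < e" "e *\<^sub>R m \<in> M" | b where "b \<in> polar" "b \<bullet> m = 1"
proof (cases "m \<in> rel_interior M")
  case True
  then obtain e where "e > 1" "(1 - e) *\<^sub>R 0 + e *\<^sub>R m \<in> M"
    using zero_mem unfolding convex_rel_interior_iff[OF convex_M M_nonempty] by blast
  then show ?thesis using that(1) by simp
next
  case False
  then obtain c where c: "\<And>y. y \<in> M \<Longrightarrow> c \<bullet> m \<le> c \<bullet> y"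
    "\<And>y. y \<in> rel_interior M \<Longrightarrow> c \<bullet> m < c \<bullet> y"
    using supporting_hyperplane_rel_boundary[OF convex_M assms] by metis
  have neg: "c \<bullet> m < 0" using c(2)[OF zero_rel_interior] by simp
  obtain b where b: "b \<in> span M" "\<And>x. x \<in> span M \<Longrightarrow> b \<bullet> x = (c /\<^sub>R (c \<bullet> m)) \<bullet> x"
    using inner_eq_on_span by blast
  have "b \<bullet> y \<le> 1" if "y \<in> M" for y
    using c(1)[OF that] neg that by (simp add: b(2) span_base divide_simps inverse_eq_divide)
  moreover have "b \<bullet> m = 1" using neg assms by (simp add: b(2) span_base)
  ultimately show ?thesis using that(2) b(1) by (auto simp: polar_def)
qed

lemma midpoint_stretch:
  assumes x: "smooth_at x u" and y: "smooth_at y v" and "u \<noteq> - v"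
  obtains e where "1 < e" "e *\<^sub>R ((1/2) *\<^sub>R (x - y)) \<in> M"
proof -
  have "(1/2) *\<^sub>R x + (1/2) *\<^sub>R (- y) \<in> M"
    using x y convex_M uminus_mem by (intro convexD) (auto simp: smooth_at_def)
  then have "(1/2) *\<^sub>R (x - y) \<in> M" by (simp add: algebra_simps)
  then consider e where "1 < e" "e *\<^sub>R ((1/2) *\<^sub>R (x - y)) \<in> M"
    | b where "b \<in> polar" "b \<bullet> ((1/2) *\<^sub>R (x - y)) = 1"
    by (rule stretch_or_supported)
  then show ?thesis
  proof cases
    case (1 e)
    then show ?thesis by (rule that)
  next
    case (2 b)
    have "b \<bullet> x \<le> 1" "b \<bullet> (- y) \<le> 1"
      using 2(1) x smooth_at_uminus[OF y] unfolding polar_def smooth_at_def by blast+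
    \<comment> \<open>Two numbers at most 1 with sum 2 both equal 1, so smoothness identifies
      \<open>b\<close> at both points.\<close>
    moreover have "b \<bullet> x + b \<bullet> (- y) = 2" using 2(2) by (simp add: inner_diff_right)
    ultimately have "b \<bullet> x = 1" "b \<bullet> (- y) = 1" by linarith+
    then have "b = u" "b = - v"
      using 2(1) x smooth_at_uminus[OF y] unfolding smooth_at_def by blast+
    with \<open>u \<noteq> - v\<close> show ?thesis by simp
  qed
qed

text \<open>A maximiser of \<open>a \<mapsto> a \<bullet> y + \<rho> \<parallel>a\<parallel>\<close> over the polar is a smooth normal: the maximum is the
  support function of the polar at some point of the ball of radius \<open>\<rho>\<close> about \<open>y\<close>, and
  the roundness of the ball makes the maximiser unique. For small \<open>\<rho>\<close> it still separates \<open>y\<close>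
  from \<open>M\<close>.\<close>
lemma smooth_separation:
  assumes "y \<in> span M" "y \<notin> M"
  obtains x u where "smooth_at x u" "1 < u \<bullet> y"
proof -
  obtain a1 where a1: "a1 \<in> polar" "1 < a1 \<bullet> y"
    by (rule polar_separation[OF assms])
  obtain R where R: "0 < R" "\<forall>a\<in>polar. norm a \<le> R"
    by (rule norm_polar_bounded)
  \<comment> \<open>\<open>\<rho> * R\<close> is half the margin by which \<open>a1\<close>
    separates \<open>y\<close>, so the norm term cannot use it up.\<close>
  define \<rho> where "\<rho> = (a1 \<bullet> y - 1) / (2 * R)"
  have "0 < \<rho>" "\<rho> * R < a1 \<bullet> y - 1" using a1(2) R(1) by (auto simp: \<rho>_def)
  have "\<exists>a\<in>polar. \<forall>b\<in>polar. b \<bullet> y + \<rho> * norm b \<le> a \<bullet> y + \<rho> * norm a"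
    using a1(1) by (intro continuous_attains_sup compact_polar) (auto intro!: continuous_intros)
  then obtain a where a: "a \<in> polar"
    and max: "\<And>b. b \<in> polar \<Longrightarrow> b \<bullet> y + \<rho> * norm b \<le> a \<bullet> y + \<rho> * norm a" by blast
  define V where "V = a \<bullet> y + \<rho> * norm a"
  have "\<rho> * norm a \<le> \<rho> * R" "0 \<le> \<rho> * norm a1"
    using R(2) a \<open>0 < \<rho>\<close> by (auto intro: mult_left_mono)
  with max[OF a1(1)] \<open>\<rho> * R < a1 \<bullet> y - 1\<close> have ay: "1 < a \<bullet> y" by linarith
  then have "a \<noteq> 0" by auto
  have "0 \<le> \<rho> * norm a" using \<open>0 < \<rho>\<close> by simp
  then have "1 < V" using ay by (simp add: V_def)
  \<comment> \<open>\<open>p\<close> is the point of the ball about \<open>y\<close> where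
    \<open>a\<close> is largest; dividing by the maximum \<open>V\<close> gives the smooth
    point.\<close>
  define p where "p = y + (\<rho> / norm a) *\<^sub>R a"
  have bp: "b \<bullet> p = b \<bullet> y + \<rho> * (b \<bullet> a / norm a)" for b by (simp add: p_def inner_add_right)
  have cs: "b \<bullet> a / norm a \<le> norm b" for b
    using norm_cauchy_schwarz[of b a] \<open>a \<noteq> 0\<close> by (simp add: divide_simps)
  have ap: "a \<bullet> p = V" using \<open>a \<noteq> 0\<close> by (simp add: bp V_def dot_square_norm power2_eq_square)
  have "p /\<^sub>R V \<in> M"
  proof (rule ccontr)
    assume "p /\<^sub>R V \<notin> M"
    moreover have "p /\<^sub>R V \<in> span M"
      using a assms(1) by (auto simp: p_def polar_def intro!: span_scale span_add)
    ultimately obtain b where b: "b \<in> polar" "1 < b \<bullet> (p /\<^sub>R V)" using polar_separation by blast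
    then have "V < b \<bullet> p" using \<open>1 < V\<close> by (simp add: divide_simps inverse_eq_divide)
    also have "\<dots> \<le> b \<bullet> y + \<rho> * norm b"
      using mult_left_mono[OF cs[of b], of \<rho>] \<open>0 < \<rho>\<close> by (simp add: bp)
    also have "\<dots> \<le> V" using max[OF b(1)] by (simp add: V_def)
    finally show False by simp
  qed
  moreover have "a \<bullet> (p /\<^sub>R V) = 1" using ap \<open>1 < V\<close> by simp
  moreover have "b = a" if b: "b \<in> polar" "b \<bullet> (p /\<^sub>R V) = 1" for b
  proof -
    have bV: "b \<bullet> p = V" using b(2) \<open>1 < V\<close> by (simp add: field_simps)
    with max[OF b(1)] have "\<rho> * norm b \<le> \<rho> * (b \<bullet> a / norm a)"
      unfolding bp V_def by linarith
    then have "norm b \<le> b \<bullet> a / norm a"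
      using \<open>0 < \<rho>\<close> by (simp only: mult_le_cancel_left_pos)
    \<comment> \<open>Equality in Cauchy-Schwarz makes \<open>b\<close> a nonnegative multiple of
      \<open>a\<close>; the common value \<open>V\<close> at \<open>p\<close> fixes the
      factor.\<close>
    then have "b \<bullet> a = norm b * norm a"
      using norm_cauchy_schwarz[of b a] \<open>a \<noteq> 0\<close> by (simp add: divide_simps)
    then have "norm b *\<^sub>R a = norm a *\<^sub>R b" by (simp add: norm_cauchy_schwarz_eq)
    then have "(1 / norm a) *\<^sub>R (norm a *\<^sub>R b) = (1 / norm a) *\<^sub>R (norm b *\<^sub>R a)" by (simp only:)
    then have eq: "b = (norm b / norm a) *\<^sub>R a" using \<open>a \<noteq> 0\<close> by simp
    have "b \<bullet> p = (norm b / norm a) * (a \<bullet> p)" by (subst eq) simp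
    then have "(norm b / norm a) * V = 1 * V" by (simp only: bV ap mult_1_left)
    moreover have "V \<noteq> 0" using \<open>1 < V\<close> by simp
    ultimately have "norm b / norm a = 1" using mult_right_cancel by blast
    with eq show ?thesis by simp
  qed
  ultimately have "smooth_at (p /\<^sub>R V) a" using a unfolding smooth_at_def by blast
  then show ?thesis using ay by (rule that)
qed

end

subsection \<open>Bodies that cover every set of the same diameter\<close>

text \<open>With \<open>M\<close> as unit ball of a norm on its span, every compact convex set of
  diameter at most 2 has to fit into a unit ball.\<close>

locale diameter_body = symmetric_convex +
  assumes translate_into: "\<lbrakk>compact_convex_set K; \<forall>x\<in>K. \<forall>y\<in>K. (1/2) *\<^sub>R (x - y) \<in> M\<rbrakk>
    \<Longrightarrow> contains_translate M K"
begin

text \<open>For fixed \<open>q\<close> the condition on \<open>p\<close> is convex, so it passes to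
  the convex hull in one argument and then, by symmetry, in the other.\<close>

lemma finite_translate_into:
  assumes "finite P" "P \<noteq> {}" and P: "\<And>p q. p \<in> P \<Longrightarrow> q \<in> P \<Longrightarrow> (1/2) *\<^sub>R (p - q) \<in> M"
  obtains w where "\<And>p. p \<in> P \<Longrightarrow> w + p \<in> M"
proof -
  have "convex {p. (1/2) *\<^sub>R (p - q) \<in> M}" for q
  proof (rule convexI)
    fix x y :: 'a and s t :: real
    assume xy: "x \<in> {p. (1/2) *\<^sub>R (p - q) \<in> M}" "y \<in> {p. (1/2) *\<^sub>R (p - q) \<in> M}"
      and st: "0 \<le> s" "0 \<le> t" "s + t = 1"
    have "s *\<^sub>R x + t *\<^sub>R y - q = s *\<^sub>R (x - q) + t *\<^sub>R (y - q)"
      using st(3) by (simp add: algebra_simps flip: scaleR_left_distrib)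
    then have "(1/2) *\<^sub>R (s *\<^sub>R x + t *\<^sub>R y - q) = s *\<^sub>R ((1/2) *\<^sub>R (x - q)) + t *\<^sub>R ((1/2) *\<^sub>R (y - q))"
      by (simp add: scaleR_right_distrib)
    also have "\<dots> \<in> M" using xy st by (intro convexD[OF convex_M]) auto
    finally show "s *\<^sub>R x + t *\<^sub>R y \<in> {p. (1/2) *\<^sub>R (p - q) \<in> M}" by simp
  qed
  then have hull: "convex hull P \<subseteq> {p. (1/2) *\<^sub>R (p - q) \<in> M}"
    if "\<And>p. p \<in> P \<Longrightarrow> (1/2) *\<^sub>R (p - q) \<in> M" for q
    using that by (intro hull_minimal) auto
  have flip: "(1/2) *\<^sub>R (x - y) \<in> M \<Longrightarrow> (1/2) *\<^sub>R (y - x) \<in> M" for x y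
    using uminus_mem[of "(1/2) *\<^sub>R (x - y)"] by (simp add: algebra_simps)
  have "(1/2) *\<^sub>R (p - q) \<in> M" if "p \<in> convex hull P" "q \<in> P" for p q
    using hull[of q] P that by blast
  then have "(1/2) *\<^sub>R (p - q) \<in> M" if "p \<in> convex hull P" "q \<in> convex hull P" for p q
    using hull[of q] flip that by blast
  then have "contains_translate M (convex hull P)"
    using assms(1,2)
    by (intro translate_into) (auto simp: compact_convex_set_def finite_imp_compact_convex_hull)
  then obtain w where "(+) w ` (convex hull P) \<subseteq> M" by (auto simp: contains_translate_def)
  then show ?thesis using hull_inc[of _ P convex] by (intro that[of w]) auto
qed

text \<open>Otherwise the convex hull of the points \<open>x i\<close>, dilated slightly, would still have all its
  half-differences in \<open>M\<close>, and the positive dependence would prevent it from being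
  translated into the half-spaces \<open>f i \<bullet> z \<le> 1\<close>.\<close>
lemma opposite_smooth_normals:
  assumes I: "finite I" "I \<noteq> {}" and f: "\<And>i. i \<in> I \<Longrightarrow> smooth_at (x i) (f i)"
    and c: "\<And>i. i \<in> I \<Longrightarrow> 0 < c i" and dep: "(\<Sum>i\<in>I. c i *\<^sub>R f i) = 0"
  shows "\<exists>i\<in>I. \<exists>j\<in>I. f i = - f j"
proof (rule ccontr)
  assume "\<not> ?thesis"
  then have "\<forall>i\<in>I. \<forall>j\<in>I. \<exists>e>1. e *\<^sub>R ((1/2) *\<^sub>R (x i - x j)) \<in> M"
    using midpoint_stretch[OF f f] by metis
  then obtain E where E: "\<And>i j. i \<in> I \<Longrightarrow> j \<in> I \<Longrightarrow> 1 < E i j \<and> E i j *\<^sub>R ((1/2) *\<^sub>R (x i - x j)) \<in> M"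
    by metis
  \<comment> \<open>Finitely many pairs have a common dilation factor above 1.\<close>
  define e where "e = Min ((\<lambda>(i, j). E i j) ` (I \<times> I))"
  have "1 < e" unfolding e_def using I E by (subst Min_gr_iff) auto
  have eE: "e \<le> E i j" if "i \<in> I" "j \<in> I" for i j
    unfolding e_def using I that by (intro Min_le) auto
  have "(1/2) *\<^sub>R (e *\<^sub>R x i - e *\<^sub>R x j) \<in> M" if ij: "i \<in> I" "j \<in> I" for i j
  proof -
    \<comment> \<open>\<open>M\<close> contains 0, so the factor may be lowered from
      \<open>E i j\<close> to \<open>e\<close>.\<close>
    have "(e / E i j) *\<^sub>R (E i j *\<^sub>R ((1/2) *\<^sub>R (x i - x j))) \<in> M"
      using E[OF ij] eE[OF ij] \<open>1 < e\<close>
      by (intro scale_mem[OF conjunct2[OF E[OF ij]]]) auto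
    moreover have "E i j \<noteq> 0" using E[OF ij] by auto
    ultimately show ?thesis by (simp add: scaleR_right_diff_distrib)
  qed
  then have "\<And>p q. p \<in> (\<lambda>i. e *\<^sub>R x i) ` I \<Longrightarrow> q \<in> (\<lambda>i. e *\<^sub>R x i) ` I \<Longrightarrow> (1/2) *\<^sub>R (p - q) \<in> M"
    by blast
  then obtain w where w: "\<And>p. p \<in> (\<lambda>i. e *\<^sub>R x i) ` I \<Longrightarrow> w + p \<in> M"
    using finite_translate_into[of "(\<lambda>i. e *\<^sub>R x i) ` I"] I by (metis finite_imageI image_is_empty)
  have "f i \<bullet> w + e \<le> 1" if i: "i \<in> I" for i
  proof -
    have "f i \<bullet> (w + e *\<^sub>R x i) \<le> 1"
      using w[of "e *\<^sub>R x i"] f[OF i] i unfolding smooth_at_def polar_def by blast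
    then show ?thesis using f[OF i] by (simp add: smooth_at_def inner_add_right)
  qed
  \<comment> \<open>The weights cancel \<open>w\<close>, leaving \<open>e\<close> times the total
    weight at most the total weight.\<close>
  then have "(\<Sum>i\<in>I. c i * (f i \<bullet> w + e)) \<le> (\<Sum>i\<in>I. c i * 1)"
    using c by (intro sum_mono mult_left_mono) (auto intro: less_imp_le)
  moreover have "(\<Sum>i\<in>I. c i * (f i \<bullet> w + e)) = (\<Sum>i\<in>I. c i *\<^sub>R f i) \<bullet> w + (\<Sum>i\<in>I. c i) * e"
    by (simp add: distrib_left sum.distrib inner_sum_left sum_distrib_right)
  moreover have "0 < (\<Sum>i\<in>I. c i)" using I c by (intro sum_pos) auto
  ultimately show False using \<open>1 < e\<close> dep by simp
qed

text \<open>For a maximal independent set \<open>G\<close> of smooth normals, a further normal would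
  be a combination of \<open>G\<close>. Absorbing signs gives a positive dependence, and an opposite
  pair in it contradicts either independence or the choice of the new normal.\<close>

lemma smooth_normals_basis:
  obtains G where "independent G" "G \<subseteq> polar"
    "\<And>x u. smooth_at x u \<Longrightarrow> u \<in> G \<or> - u \<in> G"
proof -
  define F where "F = {u. \<exists>x. smooth_at x u}"
  obtain G where G: "G \<subseteq> F" "independent G" "F \<subseteq> span G"
    using maximal_independent_subset[of F] by metis
  have "finite G" using G(2) by (rule independent_imp_finite)
  have F_uminus: "- u \<in> F" if "u \<in> F" for u
    using that smooth_at_uminus by (auto simp: F_def)
  have "u \<in> G \<or> - u \<in> G" if u: "u \<in> F" for u
  proof (rule ccontr)
    assume uG: "\<not> (u \<in> G \<or> - u \<in> G)"
    have "u \<noteq> 0" using u by (auto simp: F_def smooth_at_def)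
    obtain c where c: "u = (\<Sum>g\<in>G. c g *\<^sub>R g)"
      using u G(3) span_finite[OF \<open>finite G\<close>] by auto
    define J where "J = {g \<in> G. c g \<noteq> 0}"
    \<comment> \<open>\<open>f\<close> moves \<open>u\<close> to the other side and absorbs the
      signs of the coefficients, keeping within \<open>F\<close>; \<open>d\<close> holds the
      positive weights.\<close>
    define f where "f i = (if i = u then - u else sgn (c i) *\<^sub>R i)" for i
    define d where "d i = (if i = u then 1 else \<bar>c i\<bar>)" for i
    have J: "finite J" "u \<notin> J" "J \<subseteq> G" using \<open>finite G\<close> uG by (auto simp: J_def)
    have "(\<Sum>i\<in>J. d i *\<^sub>R f i) = (\<Sum>i\<in>J. c i *\<^sub>R i)"
      using J(2) by (intro sum.cong) (auto simp: d_def f_def abs_mult_sgn)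
    also have "\<dots> = u"
      unfolding c using \<open>finite G\<close> by (intro sum.mono_neutral_left) (auto simp: J_def)
    finally have dep: "(\<Sum>i\<in>insert u J. d i *\<^sub>R f i) = 0"
      using J by (simp add: d_def f_def)
    have "f i \<in> F" if "i \<in> insert u J" for i
      using that u F_uminus G(1) by (auto simp: f_def J_def sgn_if)
    then obtain x where "\<And>i. i \<in> insert u J \<Longrightarrow> smooth_at (x i) (f i)"
      unfolding F_def by simp metis
    moreover have "0 < d i" if "i \<in> insert u J" for i
      using that by (auto simp: d_def J_def)
    ultimately obtain i j where ij: "i \<in> insert u J" "j \<in> insert u J" "f i = - f j"
      using opposite_smooth_normals[OF _ _ _ _ dep] J(1) by blast
    have fJ: "f g = g \<or> f g = - g" "g \<in> G" "g \<noteq> u" "g \<noteq> - u" if "g \<in> J" for g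
      using that J uG by (auto simp: f_def J_def sgn_if)
    have "f u = - u" by (simp add: f_def)
    have neg_self: "x = 0" if "x = - x" for x :: 'a
      using that by (simp add: eq_neg_iff_add_eq_0 flip: scaleR_2)
    \<comment> \<open>The only possible partner of \<open>f u\<close> is \<open>u\<close>; excluding
      it confines opposite pairs to \<open>J\<close>.\<close>
    have fu: "f k \<noteq> u" if "k \<in> insert u J" for k
      using that fJ[of k] \<open>f u = - u\<close> neg_self[of u] \<open>u \<noteq> 0\<close> by (metis insertE minus_minus)
    have "i \<noteq> u" "j \<noteq> u"
      using ij fu \<open>f u = - u\<close> by (metis minus_minus)+
    then have "i \<in> J" "j \<in> J" using ij by auto
    show False
    proof (cases "i = j")
      case True
      then have "i = 0" using ij(3) fJ(1)[OF \<open>i \<in> J\<close>] neg_self by (metis minus_minus)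
      then show False using G(2) fJ(2)[OF \<open>i \<in> J\<close>] dependent_zero by blast
    next
      case False
      have "i = j \<or> i = - j"
        using ij(3) fJ(1)[OF \<open>i \<in> J\<close>] fJ(1)[OF \<open>j \<in> J\<close>]
        by (auto simp: minus_equation_iff)
      moreover have "j \<in> span (G - {i})" using False fJ(2)[OF \<open>j \<in> J\<close>] by (simp add: span_base)
      ultimately have "i \<in> span (G - {i})" using span_neg by metis
      with G(2) fJ(2)[OF \<open>i \<in> J\<close>] show False unfolding dependent_def by blast
    qed
  qed
  moreover have "G \<subseteq> polar" using G(1) by (auto simp: F_def smooth_at_def)
  ultimately show ?thesis
    by (intro that[OF G(2)]) (simp_all add: F_def, metis)
qed

text \<open>By smooth separation \<open>M\<close> is the part of \<open>span M\<close> inside the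
  slabs of the basis normals. The span itself is cut out by slabs of thickness 0 with normals
  orthogonal to it.\<close>

lemma parallelotope_translate: "parallelotope ((+) v ` M)"
proof -
  obtain G where G: "independent G" "G \<subseteq> polar"
    and GF: "\<And>x u. smooth_at x u \<Longrightarrow> u \<in> G \<or> - u \<in> G" by (rule smooth_normals_basis) metis
  have mem: "x \<in> M \<longleftrightarrow> x \<in> span M \<and> (\<forall>g\<in>G. \<bar>g \<bullet> x\<bar> \<le> 1)" for x
  proof
    assume "x \<in> M"
    moreover have "g \<bullet> x \<le> 1" "(- g) \<bullet> x \<le> 1" if "g \<in> G" for g
      using \<open>x \<in> M\<close> that G(2) uminus_polar[of g] unfolding polar_def by blast+
    ultimately show "x \<in> span M \<and> (\<forall>g\<in>G. \<bar>g \<bullet> x\<bar> \<le> 1)" by (auto simp: span_base abs_le_iff)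
  next
    assume x: "x \<in> span M \<and> (\<forall>g\<in>G. \<bar>g \<bullet> x\<bar> \<le> 1)"
    show "x \<in> M"
    proof (rule ccontr)
      assume "x \<notin> M"
      then obtain z u where "smooth_at z u" "1 < u \<bullet> x" using smooth_separation x by blast
      then show False using GF[of z u] x by fastforce
    qed
  qed
  \<comment> \<open>A nonzero \<open>x\<close> orthogonal to \<open>G\<close> would put a multiple
    longer than the bound \<open>R\<close> into \<open>M\<close>.\<close>
  have separating: "x = 0" if "x \<in> span M" "\<And>g. g \<in> G \<Longrightarrow> g \<bullet> x = 0" for x
  proof (rule ccontr)
    assume "x \<noteq> 0"
    obtain R where R: "\<And>y. y \<in> M \<Longrightarrow> norm y \<le> R"
      using compact_imp_bounded[OF compact_M] by (auto simp: bounded_iff)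
    have "((\<bar>R\<bar> + 1) / norm x) *\<^sub>R x \<in> M" using that by (simp add: mem span_scale)
    from R[OF this] show False using \<open>x \<noteq> 0\<close> by simp
  qed
  define T where "T = {z. \<forall>w\<in>span M. z \<bullet> w = 0}"
  \<comment> \<open>New vectors come only from the orthogonal complement \<open>T\<close>, and
    \<open>T\<close> lies in the span of the result.\<close>
  obtain B where B: "G \<subseteq> B" "B \<subseteq> G \<union> T" "independent B" "G \<union> T \<subseteq> span B"
    using maximal_independent_subset_extend[of G "G \<union> T"] G(1) by blast
  have decomp: "\<exists>s\<in>span M. \<exists>t\<in>T. x = s + t" for x
  proof -
    obtain y z where "y \<in> span M" "\<And>w. w \<in> span M \<Longrightarrow> orthogonal z w" "x = y + z"
      using orthogonal_subspace_decomp_exists by blast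
    then show ?thesis by (auto simp: T_def orthogonal_def)
  qed
  have GT: "g \<bullet> t = 0" if "g \<in> G" "t \<in> T" for g t
    using that G(2) by (auto simp: T_def polar_def inner_commute)
  have T0: "t = 0" if "t \<in> T" "\<And>b. b \<in> B - G \<Longrightarrow> b \<bullet> t = 0" for t
  proof -
    have "orthogonal t b" if "b \<in> B" for b
      using that \<open>t \<in> T\<close> GT \<open>\<And>b. b \<in> B - G \<Longrightarrow> b \<bullet> t = 0\<close>
      by (cases "b \<in> G") (auto simp: orthogonal_def inner_commute)
    then have "orthogonal t t"
      using orthogonal_to_span[of t B t] B(4) \<open>t \<in> T\<close> by blast
    then show ?thesis by (simp add: orthogonal_self)
  qed
  have BG: "b \<bullet> s = 0" if "b \<in> B - G" "s \<in> span M" for b s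
    using that B(2) by (auto simp: T_def)
  have memB: "x \<in> M \<longleftrightarrow> (\<forall>b\<in>B. \<bar>b \<bullet> x\<bar> \<le> (if b \<in> G then 1 else 0))" for x
  proof
    assume "x \<in> M"
    then show "\<forall>b\<in>B. \<bar>b \<bullet> x\<bar> \<le> (if b \<in> G then 1 else 0)" using mem[of x] BG[of _ x] by auto
  next
    assume x: "\<forall>b\<in>B. \<bar>b \<bullet> x\<bar> \<le> (if b \<in> G then 1 else 0)"
    obtain s t where st: "s \<in> span M" "t \<in> T" "x = s + t" using decomp by blast
    \<comment> \<open>The zero-thickness slabs eliminate the component orthogonal to
      \<open>span M\<close>.\<close>
    have "b \<bullet> t = 0" if "b \<in> B - G" for b
    proof -
      have "b \<bullet> x = 0" using x that by fastforce
      then show ?thesis using BG[OF that st(1)] by (simp add: st(3) inner_add_right)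
    qed
    then have "x = s" using T0[OF st(2)] st(3) by simp
    then show "x \<in> M" using mem[of x] st(1) x B(1) by fastforce
  qed
  have "parallelotope {x. \<forall>b\<in>B. b \<bullet> v - (if b \<in> G then 1 else 0) \<le> b \<bullet> x
      \<and> b \<bullet> x \<le> b \<bullet> v + (if b \<in> G then 1 else 0)}"
  proof (rule parallelotope_if_slabs[OF B(3)])
    fix x assume x: "\<And>b. b \<in> B \<Longrightarrow> b \<bullet> x = 0"
    obtain s t where st: "s \<in> span M" "t \<in> T" "x = s + t" using decomp by blast
    have "t = 0"
      using x BG[OF _ st(1)] by (intro T0[OF st(2)]) (metis DiffD1 add_0 inner_add_right st(3))
    then show "x = 0" using separating[of x] st x B(1) by auto
  qed auto
  moreover have "(+) v ` M = {x. \<forall>b\<in>B. b \<bullet> v - (if b \<in> G then 1 else 0) \<le> b \<bullet> x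
      \<and> b \<bullet> x \<le> b \<bullet> v + (if b \<in> G then 1 else 0)}"
  proof -
    have "(+) v ` M = {x. x - v \<in> M}" by (force simp: image_iff)
    then show ?thesis unfolding memB inner_diff_right abs_le_iff by (simp add: algebra_simps) fastforce
  qed
  ultimately show ?thesis by simp
qed

end

section \<open>The half-difference body and the converse direction\<close>

definition half_difference_body :: "'a::euclidean_space set \<Rightarrow> 'a set" where
  "half_difference_body L = {(1/2) *\<^sub>R (x - y) | x y. x \<in> L \<and> y \<in> L}"

text \<open>Differences of half-differences are differences of midpoints, which lie in
  \<open>L\<close>, so \<open>L\<close> contains a translate of its half-difference body. Equal
  widths then force equality.\<close>

lemma reliable_imp_translate_half_difference_body:
  fixes L :: "'a::euclidean_space set"
  assumes rel: "\<And>K. \<lbrakk>compact_convex_set K;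
      \<And>x y. x \<in> K \<Longrightarrow> y \<in> K \<Longrightarrow> \<exists>x'\<in>L. \<exists>y'\<in>L. x - y = x' - y'\<rbrakk> \<Longrightarrow> contains_translate L K"
    and L: "compact_convex_set L"
  obtains v where "L = (+) v ` half_difference_body L" "compact_convex_set (half_difference_body L)"
proof -
  define D where "D = half_difference_body L"
  have DI: "(1/2) *\<^sub>R (x - y) \<in> D" if "x \<in> L" "y \<in> L" for x y
    using that unfolding D_def half_difference_body_def by blast
  have L': "compact L" "convex L" "L \<noteq> {}" using L by (auto simp: compact_convex_set_def)
  have lin: "linear (\<lambda>(x, y). (1/2) *\<^sub>R (x - y :: 'a))"
    by (intro linearI) (auto simp: algebra_simps)
  have "D = (\<lambda>(x, y). (1/2) *\<^sub>R (x - y)) ` (L \<times> L)"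
    unfolding D_def half_difference_body_def
    by (auto simp only: image_iff mem_Collect_eq split_paired_Bex_Sigma prod.case)
  then have D: "compact_convex_set D"
    unfolding compact_convex_set_def using L' lin
    by (auto intro!: compact_continuous_image convex_linear_image compact_Times convex_Times
        linear_continuous_on simp: linear_conv_bounded_linear)
  have mid: "(1/2) *\<^sub>R (x + y) \<in> L" if "x \<in> L" "y \<in> L" for x y
    using convexD[OF L'(2) that, of "1/2" "1/2"] by (simp add: scaleR_right_distrib)
  have "\<exists>x'\<in>L. \<exists>y'\<in>L. p - q = x' - y'" if pq: "p \<in> D" "q \<in> D" for p q
  proof -
    obtain x y x' y' where xy: "x \<in> L" "y \<in> L" "x' \<in> L" "y' \<in> L"
      "p = (1/2) *\<^sub>R (x - y)" "q = (1/2) *\<^sub>R (x' - y')"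
      using pq unfolding D_def half_difference_body_def by blast
    have "p - q = (1/2) *\<^sub>R (x + y') - (1/2) *\<^sub>R (y + x')" by (simp add: xy algebra_simps)
    then show ?thesis using mid xy by blast
  qed
  then obtain v where v: "(+) v ` D \<subseteq> L"
    using rel[OF D] unfolding contains_translate_def by blast
  have "x \<in> (+) v ` D" if x: "x \<in> L" for x
  proof (rule ccontr)
    assume nx: "x \<notin> (+) v ` D"
    have cD: "convex ((+) v ` D)" "closed ((+) v ` D)"
      using D by (auto simp: compact_convex_set_def convex_translation compact_imp_closed
          closed_translation)
    obtain a d where ad: "a \<bullet> x < d" "\<forall>z\<in>(+) v ` D. d < a \<bullet> z"
      using separating_hyperplane_closed_point[OF cD nx] by blast
    \<comment> \<open>With \<open>y\<close> maximising \<open>a\<close>, the points \<open>v\<close>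
      plus and minus half of \<open>x - y\<close> bound \<open>a \<bullet> v\<close> by the value of
      \<open>a\<close> at the midpoint of \<open>x\<close> and \<open>y\<close>, from above and
      strictly from below.\<close>
    obtain y where y: "y \<in> L" "\<And>z. z \<in> L \<Longrightarrow> a \<bullet> z \<le> a \<bullet> y"
      using inner_attains_sup[OF L, of a] by metis
    have "a \<bullet> (v + (1/2) *\<^sub>R (y - x)) \<le> a \<bullet> y" using v DI[OF y(1) x] y(2) by blast
    moreover have "a \<bullet> x < a \<bullet> (v + (1/2) *\<^sub>R (x - y))"
      using ad(2) DI[OF x y(1)] by (intro order.strict_trans[OF ad(1)]) blast
    ultimately show False
      unfolding inner_add_right inner_diff_right inner_scaleR_right by (simp add: field_simps)
  qed
  with v have "L = (+) v ` D" by blast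
  then show ?thesis using D unfolding D_def by (rule that)
qed

lemma reliable_imp_parallelotope:
  fixes L :: "'a::euclidean_space set"
  assumes "reliable 1 L"
  shows "parallelotope L"
proof -
  have L: "compact_convex_set L" using assms by (simp add: reliable_def)
  \<comment> \<open>A difference of \<open>K\<close> that is also a difference of \<open>L\<close>
    satisfies the width inequality in every direction.\<close>
  have rel: "contains_translate L K" if "compact_convex_set K"
    "\<And>x y. x \<in> K \<Longrightarrow> y \<in> K \<Longrightarrow> \<exists>x'\<in>L. \<exists>y'\<in>L. x - y = x' - y'" for K
  proof -
    have "\<forall>u. \<forall>x\<in>K. \<forall>y\<in>K. \<exists>x'\<in>L. \<exists>y'\<in>L. u \<bullet> (x - y) \<le> u \<bullet> (x' - y')"
      using that(2) by (metis order_refl)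
    then show ?thesis
      using assms that(1) translates_of_shadows_iff_widths_le[OF that(1) L]
      unfolding reliable_def by blast
  qed
  define M where "M = half_difference_body L"
  obtain v where LM: "L = (+) v ` M" and M: "compact_convex_set M"
    using reliable_imp_translate_half_difference_body[OF rel L] unfolding M_def by metis
  interpret diameter_body M
  proof
    show "compact M" "convex M" "M \<noteq> {}" using M by (auto simp: compact_convex_set_def)
    show "- x \<in> M" if x: "x \<in> M" for x
    proof -
      obtain a b where "a \<in> L" "b \<in> L" "x = (1/2) *\<^sub>R (a - b)"
        using x unfolding M_def half_difference_body_def by blast
      then have "- x = (1/2) *\<^sub>R (b - a)" by (simp add: algebra_simps)
      with \<open>a \<in> L\<close> \<open>b \<in> L\<close> show ?thesis
        unfolding M_def half_difference_body_def by blast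
    qed
    show "contains_translate M K"
      if K: "compact_convex_set K" and diam: "\<forall>x\<in>K. \<forall>y\<in>K. (1/2) *\<^sub>R (x - y) \<in> M" for K
    proof -
      \<comment> \<open>Cancelling the factor 1/2 shows that differences of \<open>K\<close> are
        differences of \<open>L\<close>; a translate in \<open>L\<close> is then shifted back by
        \<open>v\<close>.\<close>
      have "\<exists>x'\<in>L. \<exists>y'\<in>L. x - y = x' - y'" if xy: "x \<in> K" "y \<in> K" for x y
      proof -
        obtain x' y' where "x' \<in> L" "y' \<in> L" "(1/2) *\<^sub>R (x - y) = (1/2) *\<^sub>R (x' - y')"
          using diam[rule_format, OF xy] unfolding M_def half_difference_body_def by blast
        then show ?thesis by auto
      qed
      then obtain w where "(+) w ` K \<subseteq> L" using rel[OF K] by (auto simp: contains_translate_def)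
      then have "(+) (w - v) ` K \<subseteq> M" unfolding LM by (force simp: algebra_simps)
      then show ?thesis by (auto simp: contains_translate_def)
    qed
  qed
  show ?thesis using parallelotope_translate[of v] LM by simp
qed

theorem corollary4p7:
  fixes L :: "(real ^ 'n) set"
  assumes "CARD('n) \<ge> 2"
    and "compact_convex_set L"
  shows "reliable 1 L \<longleftrightarrow> parallelotope L"
  using parallelotope_imp_reliable[OF assms(2)] reliable_imp_parallelotope by blast

end
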